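(* Let $d \geq 1$ and let $\Delta = \Delta(\mathcal{X})$ be the earth mover's (EM) simplex on a family $\mathcal{X} = (X_0, \ldots, X_d)$ of finite sets. Then \[ {\rm Vol}(\Delta) = \frac{1}{d}\Bigg( {\rm Vol}_2(\Delta) + \sum_{\text{edges } \mathcal{E} \text{ of } \Delta} {\rm Vol}(\mathcal{E}) \Bigg), \] where the sum ranges over the $\binom{d+1}{2}$ edges $\mathcal{E}=\{X_i,X_j\}$, $0\le i<j\le d$.
   Context: Let $d \geq 0$ and $\mathcal{X} = (X_0, \ldots, X_d)$ a family of finite sets (repetitions allowed; vertices are indexed by $0,\dots,d$). Write $\cup\mathcal{X} = \bigcup_i X_i$ and, for $x \in \cup\mathcal{X}$, $\deg_{\mathcal{X}}(x) = \#\{i : x \in X_i\}$. Let ${\rm Min}(\mathcal{X}), {\rm Med}(\mathcal{X}), {\rm Maj}(\mathcal{X})$ be the sets of $x\in\cup\mathcal{X}$ with $\deg_{\mathcal{X}}(x) <, =, > (d+1)/2$ respectively. The abstract $d$-simplex $\Delta(\mathcal{X})$ has as faces all subsets $\mathcal{F}$ of the vertex set $\{X_0,\dots,X_d\}$ (including $\varnothing$), with $\dim\mathcal{F} = \#\mathcal{F}-1$; a cofacet of $\mathcal{F}$ is a face $\mathcal{G}\supset\mathcal{F}$ with $\#\mathcal{G}=\#\mathcal{F}+1$; edges are faces with two vertices. Define $\epsilon(x) = \{X_i : x \in X_i\}$ if $x \in {\rm Min}(\mathcal{X})\cup{\rm Med}(\mathcal{X})$ and $\epsilon(x) = \{X_i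 : x \notin X_i\}$ if $x\in{\rm Maj}(\mathcal{X})$; this is a face of dimension at most $\lfloor (d-1)/2\rfloor$. Define labelings: for faces $\mathcal{F}$ with $\dim \mathcal{F}\le\lfloor(d-1)/2\rfloor$, $\lambda^{(0)}(\mathcal{F}) = \{x \in\cup\mathcal{X} : \epsilon(x) = \mathcal{F}\}$; recursively, for faces $\mathcal{F}$ with $\dim\mathcal{F} \le \lfloor (d-1)/2\rfloor - (i+1)$, $\lambda^{(i+1)}(\mathcal{F})$ is the multiset union of $\lambda^{(i)}(\mathcal{G})$ over all cofacets $\mathcal{G}$ of $\mathcal{F}$. The EM simplex is $\Delta(\mathcal{X})$ equipped with these labelings. The $i$th generalized volume is ${\rm Vol}_i(\Delta) = \sum_{\mathcal{F}} |\lambda^{(i)}(\mathcal{F})|$ (multiset cardinalities), summed over faces with $\dim\mathcal{F}\le\lfloor(d-1)/2\rfloor - i$, and ${\rm Vol}(\Delta) = {\rm Vol}_1(\Delta)$. For a face $\mathcal{F}$, ${\rm Vol}(\mathcal{F})$ denotes the volume of the EM simplex on the subfamily $\mathcal{F}$ (so for an edge $\{X_i,X_j\}$ it equals $|X_i \triangle X_j|$). *)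

theory Defs
  imports Complex_Main "HOL-Library.Multiset"
begin

text \<open>
  A family of sets is given by a function \<open>X\<close> together with a finite index set \<open>I\<close>. The vertices
  of the simplex are the indices, so repeated sets in the family are distinct vertices, and the
  subfamily spanned by a face \<open>F \<subseteq> I\<close> is the family given by \<open>X\<close> and \<open>F\<close>.
\<close>

definition em_Union :: "('v \<Rightarrow> 'a set) \<Rightarrow> 'v set \<Rightarrow> 'a set" where
  "em_Union X I = (\<Union>i\<in>I. X i)"

definition em_deg :: "('v \<Rightarrow> 'a set) \<Rightarrow> 'v set \<Rightarrow> 'a \<Rightarrow> nat" where
  "em_deg X I x = card {i \<in> I. x \<in> X i}"

text \<open>Since \<open>card {} = 0\<close>, the empty face has dimension \<open>-1\<close>. The simplex on \<open>I\<close> has dimension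
  \<open>d = face_dim I\<close>, so \<open>(d + 1) / 2\<close> is half the number of vertices.\<close>

definition face_dim :: "'v set \<Rightarrow> int" where
  "face_dim F = int (card F) - 1"

definition em_Min :: "('v \<Rightarrow> 'a set) \<Rightarrow> 'v set \<Rightarrow> 'a set" where
  "em_Min X I = {x \<in> em_Union X I. real (em_deg X I x) < (real_of_int (face_dim I) + 1) / 2}"

definition em_Med :: "('v \<Rightarrow> 'a set) \<Rightarrow> 'v set \<Rightarrow> 'a set" where
  "em_Med X I = {x \<in> em_Union X I. real (em_deg X I x) = (real_of_int (face_dim I) + 1) / 2}"

definition em_Maj :: "('v \<Rightarrow> 'a set) \<Rightarrow> 'v set \<Rightarrow> 'a set" where
  "em_Maj X I = {x \<in> em_Union X I. real (em_deg X I x) > (real_of_int (face_dim I) + 1) / 2}"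

definition faces :: "'v set \<Rightarrow> 'v set set" where
  "faces I = Pow I"

definition edges :: "'v set \<Rightarrow> 'v set set" where
  "edges I = {E \<in> faces I. card E = 2}"

definition cofacets :: "'v set \<Rightarrow> 'v set \<Rightarrow> 'v set set" where
  "cofacets I F = {G \<in> faces I. F \<subset> G \<and> card G = card F + 1}"

text \<open>Only used for \<open>x\<close> in \<open>em_Union X I\<close>, the disjoint union of \<open>em_Min\<close>, \<open>em_Med\<close> and
  \<open>em_Maj\<close>.\<close>

definition em_eps :: "('v \<Rightarrow> 'a set) \<Rightarrow> 'v set \<Rightarrow> 'a \<Rightarrow> 'v set" where
  "em_eps X I x =
     (if x \<in> em_Min X I \<union> em_Med X I then {i \<in> I. x \<in> X i} else {i \<in> I. x \<notin> X i})"

text \<open>The union over cofacets adds multiplicities. The \<open>i\<close>th labeling is meant on faces of dimension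
  at most \<open>\<lfloor>(d - 1) / 2\<rfloor> - i\<close>: on these the recursion only refers to values in the domain of the
  preceding labeling, and \<open>em_vol\<close> below uses no others.\<close>

primrec em_label :: "('v \<Rightarrow> 'a set) \<Rightarrow> 'v set \<Rightarrow> nat \<Rightarrow> 'v set \<Rightarrow> 'a multiset" where
  "em_label X I 0 F = mset_set {x \<in> em_Union X I. em_eps X I x = F}"
| "em_label X I (Suc i) F = (\<Sum>G\<in>cofacets I F. em_label X I i G)"

text \<open>Integer \<open>div\<close> rounds towards minus infinity.\<close>

definition em_vol :: "nat \<Rightarrow> ('v \<Rightarrow> 'a set) \<Rightarrow> 'v set \<Rightarrow> nat" where
  "em_vol i X I =
     (\<Sum>F\<in>{F \<in> faces I. face_dim F \<le> (face_dim I - 1) div 2 - int i}. size (em_label X I i F))"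

definition em_volume :: "('v \<Rightarrow> 'a set) \<Rightarrow> 'v set \<Rightarrow> nat" where
  "em_volume X I = em_vol 1 X I"

end

theory Submission imports Defs begin

text \<open>
  Unfolding the recursion, a point \<open>x\<close> occurs in the \<open>i\<close>th label of \<open>F\<close> once for each chain of
  cofacets from \<open>F\<close> up to \<open>em_eps X I x\<close>, so with \<open>k = card (em_eps X I x)\<close> it contributes
  \<open>i! (k choose i)\<close> to the \<open>i\<close>th volume: \<open>k\<close> to the volume and \<open>k (k - 1)\<close> to the second one.
  To the volumes of the edges it contributes \<open>k (d + 1 - k)\<close>, the number of pairs of vertices that
  it separates. The theorem is the identity \<open>d k = k (k - 1) + k (d + 1 - k)\<close> summed over all \<open>x\<close>.
\<close>

section \<open>The face attached to a point and its cardinality\<close>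

lemma em_eps_subset: "em_eps X I x \<subseteq> I"
  by (auto simp: em_eps_def)

text \<open>Replaces the real comparisons with half the number of vertices by comparisons in
  \<open>nat\<close>; a median point falls under the first alternative.\<close>

lemma em_eps_deg_cases:
  assumes "finite I" and "x \<in> em_Union X I"
  shows "2 * em_deg X I x \<le> card I \<and> em_eps X I x = {i \<in> I. x \<in> X i} \<or>
         2 * em_deg X I x > card I \<and> em_eps X I x = {i \<in> I. x \<notin> X i}"
proof -
  have "x \<in> em_Min X I \<union> em_Med X I \<longleftrightarrow> 2 * em_deg X I x \<le> card I"
    using assms(2) by (auto simp: em_Min_def em_Med_def face_dim_def)
  then show ?thesis
    by (auto simp: em_eps_def)
qed

lemma card_complement_incident:
  assumes "finite I"
  shows "card {i \<in> I. x \<notin> X i} = card I - em_deg X I x"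
proof -
  have "{i \<in> I. x \<notin> X i} = I - {i \<in> I. x \<in> X i}"
    by auto
  then show ?thesis
    using assms by (simp add: card_Diff_subset em_deg_def)
qed

lemma em_deg_le: "finite I \<Longrightarrow> em_deg X I x \<le> card I"
  unfolding em_deg_def by (rule card_mono) auto

lemma card_em_eps:
  assumes "finite I" and "x \<in> em_Union X I"
  shows "card (em_eps X I x) = min (em_deg X I x) (card I - em_deg X I x)"
  using em_eps_deg_cases[OF assms]
proof (elim disjE conjE)
  assume "2 * em_deg X I x \<le> card I" "em_eps X I x = {i \<in> I. x \<in> X i}"
  then show ?thesis
    by (simp flip: em_deg_def)
next
  assume "2 * em_deg X I x > card I" "em_eps X I x = {i \<in> I. x \<notin> X i}"
  then show ?thesis
    using card_complement_incident[OF assms(1), of x X] by simp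
qed

lemma card_em_eps_le:
  assumes "finite I" and "x \<in> em_Union X I"
  shows "2 * card (em_eps X I x) \<le> card I"
  using card_em_eps[OF assms] by simp

text \<open>The product is symmetric in a set of vertices and its complement, so it does not matter
  which of the two \<open>em_eps\<close> selects.\<close>

lemma card_em_eps_mult:
  assumes "finite I" and "x \<in> em_Union X I"
  shows "card (em_eps X I x) * (card I - card (em_eps X I x)) = em_deg X I x * (card I - em_deg X I x)"
  using card_em_eps[OF assms] em_deg_le[OF assms(1), of X x] by (simp add: min_def)

section \<open>Labels and generalized volumes by counting chains of cofacets\<close>

lemma finite_cofacets: "finite I \<Longrightarrow> finite (cofacets I F)"
  by (simp add: cofacets_def faces_def)

lemma cofacets_eq_insert:
  assumes "finite I" and "F \<subseteq> I"
  shows "cofacets I F = (\<lambda>a. insert a F) ` (I - F)"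
proof (intro equalityI subsetI)
  fix G assume "G \<in> cofacets I F"
  then have G: "G \<subseteq> I" "F \<subset> G" "card G = card F + 1"
    by (auto simp: cofacets_def faces_def)
  have "finite F" "finite G"
    using assms G(1) by (auto intro: finite_subset)
  then have "card (G - F) = 1"
    using G by (simp add: card_Diff_subset)
  then obtain a where "G - F = {a}"
    by (auto simp: card_1_singleton_iff)
  then show "G \<in> (\<lambda>a. insert a F) ` (I - F)"
    using G by (intro image_eqI[of _ _ a]) auto
next
  fix G assume "G \<in> (\<lambda>a. insert a F) ` (I - F)"
  then show "G \<in> cofacets I F"
    using assms by (auto simp: cofacets_def faces_def finite_subset)
qed

text \<open>Such a cofacet adds one vertex of \<open>E - F\<close>; this counts the possible first
  steps of a chain from \<open>F\<close> up to \<open>E\<close>.\<close>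

lemma card_cofacets_below:
  assumes "finite I" and "F \<subseteq> E" and "E \<subseteq> I"
  shows "card {G \<in> cofacets I F. G \<subseteq> E} = card E - card F"
proof -
  have "{G \<in> cofacets I F. G \<subseteq> E} = (\<lambda>a. insert a F) ` (E - F)"
    using assms by (auto simp: cofacets_eq_insert)
  moreover have "inj_on (\<lambda>a. insert a F) (E - F)"
    by (auto simp: inj_on_def)
  ultimately show ?thesis
    using assms by (simp add: card_image card_Diff_subset finite_subset)
qed

text \<open>A chain from \<open>F\<close> to \<open>em_eps X I x\<close> adds the \<open>i\<close>
  missing vertices one at a time, and \<open>fact i\<close> counts their orders.\<close>

lemma size_em_label:
  fixes X :: "'v \<Rightarrow> 'a set"
  assumes "finite I" and "finite (em_Union X I)" and "F \<subseteq> I"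
  shows "size (em_label X I i F) =
    (\<Sum>x\<in>em_Union X I. if F \<subseteq> em_eps X I x \<and> card (em_eps X I x) = card F + i then fact i else 0)"
  using assms(3)
proof (induction i arbitrary: F)
  case 0
  have "em_eps X I x = F \<longleftrightarrow> F \<subseteq> em_eps X I x \<and> card (em_eps X I x) = card F" for x
    using card_subset_eq[OF finite_subset[OF em_eps_subset[of X I x] assms(1)], of F] by auto
  then show ?case
    using assms(2) by (simp add: sum.If_cases Int_def)
next
  case (Suc i)
  \<comment> \<open>The multiplicity of a point depends only on its face \<open>E\<close>, so the
    recursion can be checked for a fixed \<open>E\<close>.\<close>
  define c where "c i F E = (if F \<subseteq> E \<and> card E = card F + i then fact i else 0 :: nat)"
    for i and F E :: "'v set"
  have step: "(\<Sum>G\<in>cofacets I F. c i G E) = c (Suc i) F E" if "E \<subseteq> I" for E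
  proof (cases "F \<subseteq> E")
    case True
    \<comment> \<open>Cofacets outside \<open>E\<close> contribute 0. If the condition holds,
      \<open>Suc i\<close> of them lie below \<open>E\<close> and each contributes
      \<open>fact i\<close>, which gives \<open>fact (Suc i)\<close>.\<close>
    have "(\<Sum>G\<in>cofacets I F. c i G E) =
      (\<Sum>G\<in>{G \<in> cofacets I F. G \<subseteq> E}. if card E = card F + Suc i then fact i else 0)"
      using finite_cofacets[OF assms(1)]
      by (intro sum.mono_neutral_cong_right) (auto simp: c_def cofacets_def)
    also have "\<dots> = c (Suc i) F E"
      using card_cofacets_below[OF assms(1) True that] True by (simp add: c_def)
    finally show ?thesis .
  next
    case False
    then have "c i G E = 0" if "G \<in> cofacets I F" for G
      using that by (auto simp: c_def cofacets_def)
    with False show ?thesis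
      by (simp add: c_def)
  qed
  have "size (em_label X I (Suc i) F) = (\<Sum>G\<in>cofacets I F. size (em_label X I i G))"
    by (simp add: size_multiset_sum)
  also have "\<dots> = (\<Sum>G\<in>cofacets I F. \<Sum>x\<in>em_Union X I. c i G (em_eps X I x))"
    by (intro sum.cong refl) (simp add: Suc.IH c_def cofacets_def faces_def)
  also have "\<dots> = (\<Sum>x\<in>em_Union X I. \<Sum>G\<in>cofacets I F. c i G (em_eps X I x))"
    by (rule sum.swap)
  also have "\<dots> = (\<Sum>x\<in>em_Union X I. c (Suc i) F (em_eps X I x))"
    by (simp add: step em_eps_subset)
  finally show ?case
    by (simp only: c_def)
qed

lemma em_vol_eq:
  assumes "finite I" and "finite (em_Union X I)"
  shows "em_vol i X I = (\<Sum>x\<in>em_Union X I. fact i * (card (em_eps X I x) choose i))"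
proof -
  define B where "B = {F \<in> faces I. face_dim F \<le> (face_dim I - 1) div 2 - int i}"
  have "finite B"
    using assms(1) by (simp add: B_def faces_def)
  have "em_vol i X I = (\<Sum>F\<in>B. \<Sum>x\<in>em_Union X I.
      if F \<subseteq> em_eps X I x \<and> card (em_eps X I x) = card F + i then fact i else 0)"
    unfolding em_vol_def B_def
    by (intro sum.cong refl) (simp add: size_em_label[OF assms] faces_def)
  also have "\<dots> = (\<Sum>x\<in>em_Union X I. \<Sum>F\<in>B.
      if F \<subseteq> em_eps X I x \<and> card (em_eps X I x) = card F + i then fact i else 0)"
    by (rule sum.swap)
  also have "\<dots> = (\<Sum>x\<in>em_Union X I. fact i * (card (em_eps X I x) choose i))"
  proof (rule sum.cong[OF refl])
    fix x assume x: "x \<in> em_Union X I"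
    let ?E = "em_eps X I x"
    have fin: "finite ?E"
      using em_eps_subset assms(1) by (rule finite_subset)
    have half: "2 * card ?E \<le> card I"
      by (rule card_em_eps_le[OF assms(1) x])
    have "(\<Sum>F\<in>B. if F \<subseteq> ?E \<and> card ?E = card F + i then fact i else 0) =
        fact i * card {F \<in> B. F \<subseteq> ?E \<and> card ?E = card F + i}"
      using \<open>finite B\<close> by (simp add: sum.If_cases Int_def)
    \<comment> \<open>The dimension bound in \<open>B\<close> is automatic:
      \<open>card F = card ?E - i\<close>, and \<open>?E\<close> has at most half of the
      vertices.\<close>
    also have "{F \<in> B. F \<subseteq> ?E \<and> card ?E = card F + i} = {F. F \<subseteq> ?E \<and> card ?E = card F + i}"
      using half em_eps_subset[of X I x] by (auto simp: B_def faces_def face_dim_def)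
    also have "card \<dots> = card ?E choose i"
    \<comment> \<open>For \<open>i > card ?E\<close> the difference \<open>card ?E - i\<close> would
      truncate to 0; there both the set and the binomial coefficient vanish.\<close>
    proof (cases "i \<le> card ?E")
      case True
      then have "{F. F \<subseteq> ?E \<and> card ?E = card F + i} = {F. F \<subseteq> ?E \<and> card F = card ?E - i}"
        by auto
      then show ?thesis
        using True fin by (simp add: n_subsets binomial_symmetric[of i])
    qed (auto simp: binomial_eq_0)
    finally show "(\<Sum>F\<in>B. if F \<subseteq> ?E \<and> card ?E = card F + i then fact i else 0) =
        fact i * (card ?E choose i)" .
  qed
  finally show ?thesis .
qed

section \<open>Volumes of edges\<close>

lemma em_volume_edge:
  assumes "card E = 2" and "finite (em_Union X E)"
  shows "em_volume X E = card {x \<in> em_Union X E. em_deg X E x = 1}"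
proof -
  have "finite E"
    using assms(1) card.infinite by fastforce
  \<comment> \<open>With two vertices, a point of degree 1 is median and its face is a single
    vertex; a point of degree 2 has the empty face.\<close>
  have "card (em_eps X E x) = of_bool (em_deg X E x = 1)" if "x \<in> em_Union X E" for x
  proof -
    have "em_deg X E x > 0"
      using that \<open>finite E\<close> by (auto simp: em_deg_def em_Union_def card_gt_0_iff)
    then show ?thesis
      using em_deg_le[OF \<open>finite E\<close>, of X x] assms(1) card_em_eps[OF \<open>finite E\<close> that] by auto
  qed
  then have "em_volume X E = (\<Sum>x\<in>em_Union X E. of_bool (em_deg X E x = 1))"
    by (simp add: em_volume_def em_vol_eq \<open>finite E\<close> assms(2))
  then show ?thesis
    using assms(2) by (simp add: Int_def)
qed

text \<open>These edges join a vertex of \<open>A\<close> to a vertex of \<open>I - A\<close>, and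
  each is determined by this pair of endpoints.\<close>

lemma card_separating_edges:
  assumes "finite I" and "A \<subseteq> I"
  shows "card {E \<in> edges I. card (E \<inter> A) = 1} = card A * (card I - card A)"
proof -
  have "{E \<in> edges I. card (E \<inter> A) = 1} = (\<lambda>(a, b). {a, b}) ` (A \<times> (I - A))"
  proof (intro equalityI subsetI)
    fix E assume "E \<in> {E \<in> edges I. card (E \<inter> A) = 1}"
    then have E: "E \<subseteq> I" "card E = 2" "card (E \<inter> A) = 1"
      by (auto simp: edges_def faces_def)
    have "card (E - A) = 1"
      using E finite_subset[OF E(1) assms(1)] by (simp add: card_Diff_subset_Int)
    with E(3) obtain a b where "E \<inter> A = {a}" "E - A = {b}"
      by (auto simp: card_1_singleton_iff)
    then have "E = {a, b}" "a \<in> A" "b \<in> I - A"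
      using E(1) by auto
    then show "E \<in> (\<lambda>(a, b). {a, b}) ` (A \<times> (I - A))"
      by auto
  next
    fix E assume "E \<in> (\<lambda>(a, b). {a, b}) ` (A \<times> (I - A))"
    then obtain a b where ab: "E = {a, b}" "a \<in> A" "b \<in> I" "b \<notin> A"
      by auto
    then have "E \<inter> A = {a}" "a \<noteq> b"
      by auto
    then show "E \<in> {E \<in> edges I. card (E \<inter> A) = 1}"
      using ab assms(2) by (auto simp: edges_def faces_def)
  qed
  moreover have "inj_on (\<lambda>(a, b). {a, b}) (A \<times> (I - A))"
    by (auto simp: inj_on_def doubleton_eq_iff)
  ultimately show ?thesis
    using assms by (simp add: card_image card_cartesian_product card_Diff_subset finite_subset)
qed

text \<open>Double counting: a point contributes 1 to exactly those edges that separate the vertices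
  containing it from the others.\<close>

lemma sum_em_volume_edges:
  assumes "finite I" and "finite (em_Union X I)"
  shows "(\<Sum>E\<in>edges I. em_volume X E) =
    (\<Sum>x\<in>em_Union X I. card (em_eps X I x) * (card I - card (em_eps X I x)))"
proof -
  have fin: "finite (edges I)"
    using assms(1) by (simp add: edges_def faces_def)
  \<comment> \<open>Extending the range to \<open>em_Union X I\<close>, which is independent of
    \<open>E\<close>, allows the sums to be swapped; the added points have degree 0 in
    \<open>E\<close>.\<close>
  have "em_volume X E = (\<Sum>x\<in>em_Union X I. of_bool (em_deg X E x = 1))" if "E \<in> edges I" for E
  proof -
    have E: "E \<subseteq> I" "card E = 2"
      using that by (auto simp: edges_def faces_def)
    then have sub: "em_Union X E \<subseteq> em_Union X I"
      by (auto simp: em_Union_def)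
    have "x \<in> em_Union X E" if "em_deg X E x = 1" for x
      using that by (auto simp: em_deg_def em_Union_def card_1_singleton_iff)
    then have "{x \<in> em_Union X E. em_deg X E x = 1} = {x \<in> em_Union X I. em_deg X E x = 1}"
      using sub by auto
    then show ?thesis
      using em_volume_edge[OF E(2) finite_subset[OF sub assms(2)]] assms(2) by (simp add: Int_def)
  qed
  then have "(\<Sum>E\<in>edges I. em_volume X E) =
      (\<Sum>E\<in>edges I. \<Sum>x\<in>em_Union X I. of_bool (em_deg X E x = 1))"
    by simp
  also have "\<dots> = (\<Sum>x\<in>em_Union X I. \<Sum>E\<in>edges I. of_bool (em_deg X E x = 1))"
    by (rule sum.swap)
  also have "\<dots> = (\<Sum>x\<in>em_Union X I. em_deg X I x * (card I - em_deg X I x))"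
  proof (rule sum.cong[OF refl])
    fix x
    let ?A = "{i \<in> I. x \<in> X i}"
    have "em_deg X E x = card (E \<inter> ?A)" if "E \<in> edges I" for E
      unfolding em_deg_def using that by (intro arg_cong[of _ _ card]) (auto simp: edges_def faces_def)
    then have "(\<Sum>E\<in>edges I. of_bool (em_deg X E x = 1)) =
        (\<Sum>E\<in>edges I. of_bool (card (E \<inter> ?A) = 1) :: nat)"
      by simp
    also have "\<dots> = card {E \<in> edges I. card (E \<inter> ?A) = 1}"
      using fin by (simp add: Int_def)
    also have "\<dots> = em_deg X I x * (card I - em_deg X I x)"
      using card_separating_edges[OF assms(1), of ?A] by (simp add: em_deg_def)
    finally show "(\<Sum>E\<in>edges I. of_bool (em_deg X E x = 1)) =
        em_deg X I x * (card I - em_deg X I x)" .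
  qed
  also have "\<dots> = (\<Sum>x\<in>em_Union X I. card (em_eps X I x) * (card I - card (em_eps X I x)))"
    by (intro sum.cong refl card_em_eps_mult[OF assms(1), symmetric])
  finally show ?thesis .
qed

text \<open>The theorem without division, in \<open>nat\<close>, with \<open>card I - 1\<close> as
  the dimension \<open>d\<close>.\<close>

lemma face_dim_mult_em_volume:
  assumes "finite I" and "finite (em_Union X I)"
  shows "(card I - 1) * em_volume X I = em_vol 2 X I + (\<Sum>E\<in>edges I. em_volume X E)"
proof -
  have "(card I - 1) * k = 2 * (k choose 2) + k * (card I - k)" if le: "k \<le> card I" for k
  proof (cases k)
    case (Suc m)
    \<comment> \<open>Writing \<open>card I\<close> as a sum eliminates the truncated
      subtractions.\<close>
    then obtain n where "card I = Suc m + n"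
      using le_Suc_ex[OF le] by auto
    \<comment> \<open>The absorption identity for binomial coefficients; the factor 2 is the
      \<open>fact 2\<close> of the second volume.\<close>
    moreover have "2 * (Suc m choose 2) = Suc m * m"
      using Suc_times_binomial_eq[of m 1] by (simp add: numeral_2_eq_2 del: binomial_Suc_Suc)
    ultimately show ?thesis
      using Suc by (simp add: algebra_simps)
  qed simp
  then have eps: "(card I - 1) * card (em_eps X I x) = 2 * (card (em_eps X I x) choose 2) +
      card (em_eps X I x) * (card I - card (em_eps X I x))" for x
    using card_mono[OF assms(1) em_eps_subset[of X I x]] .
  have "(card I - 1) * em_volume X I = (\<Sum>x\<in>em_Union X I. (card I - 1) * card (em_eps X I x))"
    by (simp add: em_volume_def em_vol_eq[OF assms] sum_distrib_left)
  also have "\<dots> = em_vol 2 X I + (\<Sum>E\<in>edges I. em_volume X E)"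
    by (simp only: eps sum.distrib em_vol_eq[OF assms] sum_em_volume_edges[OF assms] fact_2)
  finally show ?thesis .
qed

theorem theorem4p1:
  fixes X :: "nat \<Rightarrow> 'a set" and d :: nat
  assumes "d \<ge> 1"
    and "\<And>i. i \<le> d \<Longrightarrow> finite (X i)"
  shows "real (em_volume X {0..d}) =
    1 / real d * (real (em_vol 2 X {0..d}) + (\<Sum>E\<in>edges {0..d}. real (em_volume X E)))"
proof -
  have "finite (em_Union X {0..d})"
    using assms(2) by (simp add: em_Union_def)
  then have "d * em_volume X {0..d} = em_vol 2 X {0..d} + (\<Sum>E\<in>edges {0..d}. em_volume X E)"
    using face_dim_mult_em_volume[of "{0..d}" X] by simp
  then have "real d * real (em_volume X {0..d}) =
      real (em_vol 2 X {0..d}) + (\<Sum>E\<in>edges {0..d}. real (em_volume X E))"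
    by (metis of_nat_add of_nat_mult of_nat_sum)
  then show ?thesis
    using assms(1) by (simp add: field_simps)
qed

end
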